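(* Let $H$ be an object in a category $\mathbb{X}$ with finite biproducts such that its identity $1_H:H\to H$ has an additive inverse $-1_H:H\to H$. Then for the Hopf monad $H\oplus-$ on $\mathbb{X}$, the induced fusion invertor $\mathsf{h}^\circ_A:H\oplus A\to H\oplus A\oplus H\oplus\mathsf{0}$ is of the form $$\mathsf{h}^\circ_A=\iota_1\circ\pi_1+\iota_2\circ\pi_2+\iota_3\circ(-1_H)\circ\pi_1.$$
   Context: In a category $\mathbb{X}$ with finite biproducts, $\oplus$ denotes the biproduct, with injections $\iota_j:A_j\to A_1\oplus\cdots\oplus A_n$ and projections $\pi_j:A_1\oplus\cdots\oplus A_n\to A_j$; $\mathsf{0}$ denotes the zero object; $f+g$ denotes the sum of parallel maps and $0$ the zero maps in the induced commutative monoid enrichment (negatives are not assumed in general). An additive inverse of $1_H$ is a map $-1_H:H\to H$ with $1_H+(-1_H)=0$. A monad is a triple $(\mathsf{T},\mu,\eta)$ with multiplication $\mu_A:\mathsf{T}\mathsf{T}(A)\to\mathsf{T}(A)$ and unit $\eta_A:A\to\mathsf{T}(A)$. For an object $H$, $\mathsf{T}(-)=H\oplus-$ is a monad with $\mu_A:H\oplus H\oplus A\to H\oplus A$, $\mu_A=\iota_1\circ\pi_1+\iota_1\circ\pi_2+\iota_2\circ\pi_3$, and $\eta_A=\iota_2:A\to H\oplus A$. The fusion operator of a monad $(\mathsf{T},\mu,\eta)$ on $\mathbb{X}$ is the natural transformation $\mathsf{h}_{A,B}:\mathsf{T}(A\oplus\mathsf{T}(B))\to\mathsf{T}(A)\oplus\mathsf{T}(B)$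 defined by $\mathsf{h}_{A,B}=\iota_1\circ\mathsf{T}(\pi_1)+\iota_2\circ\mu_B\circ\mathsf{T}(\pi_2)$. The monad is a Hopf monad if $\mathsf{h}$ is a natural isomorphism. When $1_H$ has an additive inverse, $H\oplus-$ is a Hopf monad, with $\mathsf{h}^{-1}_{A,B}:H\oplus A\oplus H\oplus B\to H\oplus A\oplus H\oplus B$ given by $\mathsf{h}^{-1}_{A,B}=\iota_1\circ\pi_1+\iota_2\circ\pi_2+\iota_3\circ(-1_H)\circ\pi_1+\iota_3\circ\pi_3+\iota_4\circ\pi_4$. The induced fusion invertor of a Hopf monad is the natural transformation $\mathsf{h}^\circ_A:\mathsf{T}(A)\to\mathsf{T}(A\oplus\mathsf{T}(\mathsf{0}))$ given by $\mathsf{h}^\circ_A=\mathsf{h}^{-1}_{A,\mathsf{0}}\circ\iota_1$, where $\iota_1:\mathsf{T}(A)\to\mathsf{T}(A)\oplus\mathsf{T}(\mathsf{0})$ is the first injection. *)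

theory Defs
  imports Main
begin

section \<open>Categories\<close>

record ('o, 'm) cat_data =
  Obj :: "'o set"
  Arr :: "'m set"
  Dom :: "'m \<Rightarrow> 'o"
  Cod :: "'m \<Rightarrow> 'o"
  Id :: "'o \<Rightarrow> 'm"
  Comp :: "'m \<Rightarrow> 'm \<Rightarrow> 'm" (infixr "\<cdot>\<index>" 70)

definition hom :: "('o, 'm, 'e) cat_data_scheme \<Rightarrow> 'o \<Rightarrow> 'o \<Rightarrow> 'm set" where
  "hom X A B = {f \<in> Arr X. Dom X f = A \<and> Cod X f = B}"

locale category =
  fixes X :: "('o, 'm, 'e) cat_data_scheme" (structure)
  assumes Dom_Obj: "f \<in> Arr X \<Longrightarrow> Dom X f \<in> Obj X"
    and Cod_Obj: "f \<in> Arr X \<Longrightarrow> Cod X f \<in> Obj X"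
    and Id_hom: "A \<in> Obj X \<Longrightarrow> Id X A \<in> hom X A A"
    and Comp_hom: "\<lbrakk>f \<in> hom X A B; g \<in> hom X B C\<rbrakk> \<Longrightarrow> g \<cdot> f \<in> hom X A C"
    and Comp_Id: "f \<in> hom X A B \<Longrightarrow> f \<cdot> Id X A = f"
    and Id_Comp: "f \<in> hom X A B \<Longrightarrow> Id X B \<cdot> f = f"
    and Comp_assoc: "\<lbrakk>f \<in> hom X A B; g \<in> hom X B C; h \<in> hom X C D\<rbrakk>
          \<Longrightarrow> (h \<cdot> g) \<cdot> f = h \<cdot> (g \<cdot> f)"

definition inverse_arrows :: "('o, 'm, 'e) cat_data_scheme \<Rightarrow> 'm \<Rightarrow> 'm \<Rightarrow> bool" where
  "inverse_arrows X f g \<longleftrightarrow> f \<in> Arr X \<and> g \<in> hom X (Cod X f) (Dom X f)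
     \<and> g \<cdot>\<^bsub>X\<^esub> f = Id X (Dom X f) \<and> f \<cdot>\<^bsub>X\<^esub> g = Id X (Cod X f)"

definition iso :: "('o, 'm, 'e) cat_data_scheme \<Rightarrow> 'm \<Rightarrow> bool" where
  "iso X f \<longleftrightarrow> (\<exists>g. inverse_arrows X f g)"

definition inverse_of :: "('o, 'm, 'e) cat_data_scheme \<Rightarrow> 'm \<Rightarrow> 'm" where
  "inverse_of X f = (THE g. inverse_arrows X f g)"

section \<open>Finite biproducts\<close>

text \<open>A zero object together with a choice of binary biproducts; no enrichment is assumed,
  the addition of parallel maps is the induced one.\<close>

record ('o, 'm) biprod_data = "('o, 'm) cat_data" +
  zero_obj :: "'o"
  biprod :: "'o \<Rightarrow> 'o \<Rightarrow> 'o" (infixr "\<oplus>\<index>" 65)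
  inj1 :: "'o \<Rightarrow> 'o \<Rightarrow> 'm"
  inj2 :: "'o \<Rightarrow> 'o \<Rightarrow> 'm"
  proj1 :: "'o \<Rightarrow> 'o \<Rightarrow> 'm"
  proj2 :: "'o \<Rightarrow> 'o \<Rightarrow> 'm"

definition zero_map :: "('o, 'm, 'e) biprod_data_scheme \<Rightarrow> 'o \<Rightarrow> 'o \<Rightarrow> 'm" where
  "zero_map X A B =
     (THE g. g \<in> hom X (zero_obj X) B) \<cdot>\<^bsub>X\<^esub> (THE f. f \<in> hom X A (zero_obj X))"

locale finite_biproducts = category X
  for X :: "('o, 'm, 'e) biprod_data_scheme" (structure) +
  assumes zero_Obj: "zero_obj X \<in> Obj X"
    and zero_terminal: "A \<in> Obj X \<Longrightarrow> \<exists>!f. f \<in> hom X A (zero_obj X)"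
    and zero_initial: "A \<in> Obj X \<Longrightarrow> \<exists>!f. f \<in> hom X (zero_obj X) A"
    and biprod_Obj: "\<lbrakk>A \<in> Obj X; B \<in> Obj X\<rbrakk> \<Longrightarrow> A \<oplus> B \<in> Obj X"
    and inj1_hom: "\<lbrakk>A \<in> Obj X; B \<in> Obj X\<rbrakk> \<Longrightarrow> inj1 X A B \<in> hom X A (A \<oplus> B)"
    and inj2_hom: "\<lbrakk>A \<in> Obj X; B \<in> Obj X\<rbrakk> \<Longrightarrow> inj2 X A B \<in> hom X B (A \<oplus> B)"
    and proj1_hom: "\<lbrakk>A \<in> Obj X; B \<in> Obj X\<rbrakk> \<Longrightarrow> proj1 X A B \<in> hom X (A \<oplus> B) A"
    and proj2_hom: "\<lbrakk>A \<in> Obj X; B \<in> Obj X\<rbrakk> \<Longrightarrow> proj2 X A B \<in> hom X (A \<oplus> B) B"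
    and product: "\<lbrakk>A \<in> Obj X; B \<in> Obj X; f \<in> hom X C A; g \<in> hom X C B\<rbrakk>
          \<Longrightarrow> \<exists>!h. h \<in> hom X C (A \<oplus> B) \<and> proj1 X A B \<cdot> h = f \<and> proj2 X A B \<cdot> h = g"
    and coproduct: "\<lbrakk>A \<in> Obj X; B \<in> Obj X; f \<in> hom X A C; g \<in> hom X B C\<rbrakk>
          \<Longrightarrow> \<exists>!h. h \<in> hom X (A \<oplus> B) C \<and> h \<cdot> inj1 X A B = f \<and> h \<cdot> inj2 X A B = g"
    and proj1_inj1: "\<lbrakk>A \<in> Obj X; B \<in> Obj X\<rbrakk> \<Longrightarrow> proj1 X A B \<cdot> inj1 X A B = Id X A"
    and proj2_inj2: "\<lbrakk>A \<in> Obj X; B \<in> Obj X\<rbrakk> \<Longrightarrow> proj2 X A B \<cdot> inj2 X A B = Id X B"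
    and proj1_inj2: "\<lbrakk>A \<in> Obj X; B \<in> Obj X\<rbrakk> \<Longrightarrow> proj1 X A B \<cdot> inj2 X A B = zero_map X B A"
    and proj2_inj1: "\<lbrakk>A \<in> Obj X; B \<in> Obj X\<rbrakk> \<Longrightarrow> proj2 X A B \<cdot> inj1 X A B = zero_map X A B"

definition pair :: "('o, 'm, 'e) biprod_data_scheme \<Rightarrow> 'm \<Rightarrow> 'm \<Rightarrow> 'm" where
  "pair X f g = (THE h. h \<in> hom X (Dom X f) (Cod X f \<oplus>\<^bsub>X\<^esub> Cod X g)
     \<and> proj1 X (Cod X f) (Cod X g) \<cdot>\<^bsub>X\<^esub> h = f \<and> proj2 X (Cod X f) (Cod X g) \<cdot>\<^bsub>X\<^esub> h = g)"

definition copair :: "('o, 'm, 'e) biprod_data_scheme \<Rightarrow> 'm \<Rightarrow> 'm \<Rightarrow> 'm" where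
  "copair X f g = (THE h. h \<in> hom X (Dom X f \<oplus>\<^bsub>X\<^esub> Dom X g) (Cod X f)
     \<and> h \<cdot>\<^bsub>X\<^esub> inj1 X (Dom X f) (Dom X g) = f \<and> h \<cdot>\<^bsub>X\<^esub> inj2 X (Dom X f) (Dom X g) = g)"

definition biprod_map :: "('o, 'm, 'e) biprod_data_scheme \<Rightarrow> 'm \<Rightarrow> 'm \<Rightarrow> 'm" where
  "biprod_map X f g =
     pair X (f \<cdot>\<^bsub>X\<^esub> proj1 X (Dom X f) (Dom X g)) (g \<cdot>\<^bsub>X\<^esub> proj2 X (Dom X f) (Dom X g))"

text \<open>Codiagonal after \<open>f \<oplus> g\<close> after diagonal; meaningful for parallel \<open>f\<close> and \<open>g\<close>.\<close>

definition map_add :: "('o, 'm, 'e) biprod_data_scheme \<Rightarrow> 'm \<Rightarrow> 'm \<Rightarrow> 'm"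
    (infixl "\<^bold>+\<index>" 65) where
  "f \<^bold>+\<^bsub>X\<^esub> g = copair X (Id X (Cod X f)) (Id X (Cod X f))
     \<cdot>\<^bsub>X\<^esub> biprod_map X f g \<cdot>\<^bsub>X\<^esub> pair X (Id X (Dom X f)) (Id X (Dom X f))"

definition additive_inverse :: "('o, 'm, 'e) biprod_data_scheme \<Rightarrow> 'm \<Rightarrow> 'm \<Rightarrow> bool" where
  "additive_inverse X f g \<longleftrightarrow> f \<in> Arr X \<and> g \<in> hom X (Dom X f) (Cod X f)
     \<and> f \<^bold>+\<^bsub>X\<^esub> g = zero_map X (Dom X f) (Cod X f)"

text \<open>\<open>A\<^sub>1 \<oplus> \<dots> \<oplus> A\<^sub>n\<close> is bracketed to the right. The indices of \<open>inj_n\<close> and \<open>proj_n\<close> start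
  at 1; values at indices outside \<open>{1..n}\<close> have no meaning.\<close>

fun biprod_n :: "('o, 'm, 'e) biprod_data_scheme \<Rightarrow> 'o list \<Rightarrow> 'o" where
  "biprod_n X [] = zero_obj X"
| "biprod_n X [A] = A"
| "biprod_n X (A # B # As) = A \<oplus>\<^bsub>X\<^esub> biprod_n X (B # As)"

fun inj_n :: "('o, 'm, 'e) biprod_data_scheme \<Rightarrow> 'o list \<Rightarrow> nat \<Rightarrow> 'm" where
  "inj_n X [] j = undefined"
| "inj_n X [A] j = Id X A"
| "inj_n X (A # B # As) j =
     (if j = 1 then inj1 X A (biprod_n X (B # As))
      else inj2 X A (biprod_n X (B # As)) \<cdot>\<^bsub>X\<^esub> inj_n X (B # As) (j - 1))"

fun proj_n :: "('o, 'm, 'e) biprod_data_scheme \<Rightarrow> 'o list \<Rightarrow> nat \<Rightarrow> 'm" where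
  "proj_n X [] j = undefined"
| "proj_n X [A] j = Id X A"
| "proj_n X (A # B # As) j =
     (if j = 1 then proj1 X A (biprod_n X (B # As))
      else proj_n X (B # As) (j - 1) \<cdot>\<^bsub>X\<^esub> proj2 X A (biprod_n X (B # As)))"

section \<open>Monads and Hopf monads\<close>

record ('o, 'm) monad_data =
  TObj :: "'o \<Rightarrow> 'o"
  TArr :: "'m \<Rightarrow> 'm"
  mult :: "'o \<Rightarrow> 'm"
  unit :: "'o \<Rightarrow> 'm"

locale monad = category X
  for X :: "('o, 'm, 'e) cat_data_scheme" (structure)
    and T :: "('o, 'm) monad_data" +
  assumes T_Obj: "A \<in> Obj X \<Longrightarrow> TObj T A \<in> Obj X"
    and T_hom: "f \<in> hom X A B \<Longrightarrow> TArr T f \<in> hom X (TObj T A) (TObj T B)"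
    and T_Id: "A \<in> Obj X \<Longrightarrow> TArr T (Id X A) = Id X (TObj T A)"
    and T_Comp: "\<lbrakk>f \<in> hom X A B; g \<in> hom X B C\<rbrakk> \<Longrightarrow> TArr T (g \<cdot> f) = TArr T g \<cdot> TArr T f"
    and mult_hom: "A \<in> Obj X \<Longrightarrow> mult T A \<in> hom X (TObj T (TObj T A)) (TObj T A)"
    and mult_natural: "f \<in> hom X A B \<Longrightarrow> mult T B \<cdot> TArr T (TArr T f) = TArr T f \<cdot> mult T A"
    and unit_hom: "A \<in> Obj X \<Longrightarrow> unit T A \<in> hom X A (TObj T A)"
    and unit_natural: "f \<in> hom X A B \<Longrightarrow> unit T B \<cdot> f = TArr T f \<cdot> unit T A"
    and mult_assoc: "A \<in> Obj X \<Longrightarrow> mult T A \<cdot> TArr T (mult T A) = mult T A \<cdot> mult T (TObj T A)"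
    and mult_unit_left: "A \<in> Obj X \<Longrightarrow> mult T A \<cdot> unit T (TObj T A) = Id X (TObj T A)"
    and mult_unit_right: "A \<in> Obj X \<Longrightarrow> mult T A \<cdot> TArr T (unit T A) = Id X (TObj T A)"

definition fusion ::
  "('o, 'm, 'e) biprod_data_scheme \<Rightarrow> ('o, 'm) monad_data \<Rightarrow> 'o \<Rightarrow> 'o \<Rightarrow> 'm" where
  "fusion X T A B =
     inj1 X (TObj T A) (TObj T B) \<cdot>\<^bsub>X\<^esub> TArr T (proj1 X A (TObj T B))
     \<^bold>+\<^bsub>X\<^esub> inj2 X (TObj T A) (TObj T B) \<cdot>\<^bsub>X\<^esub> mult T B \<cdot>\<^bsub>X\<^esub> TArr T (proj2 X A (TObj T B))"

locale hopf_monad = finite_biproducts X + monad X T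
  for X :: "('o, 'm, 'e) biprod_data_scheme" (structure)
    and T :: "('o, 'm) monad_data" +
  assumes fusion_hom: "\<lbrakk>A \<in> Obj X; B \<in> Obj X\<rbrakk> \<Longrightarrow>
        fusion X T A B \<in> hom X (TObj T (A \<oplus> TObj T B)) (TObj T A \<oplus> TObj T B)"
    and fusion_natural: "\<lbrakk>f \<in> hom X A A'; g \<in> hom X B B'\<rbrakk> \<Longrightarrow>
        fusion X T A' B' \<cdot> TArr T (biprod_map X f (TArr T g))
        = biprod_map X (TArr T f) (TArr T g) \<cdot> fusion X T A B"
    and fusion_iso: "\<lbrakk>A \<in> Obj X; B \<in> Obj X\<rbrakk> \<Longrightarrow> iso X (fusion X T A B)"

definition fusion_invertor ::
  "('o, 'm, 'e) biprod_data_scheme \<Rightarrow> ('o, 'm) monad_data \<Rightarrow> 'o \<Rightarrow> 'm" where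
  "fusion_invertor X T A =
     inverse_of X (fusion X T A (zero_obj X)) \<cdot>\<^bsub>X\<^esub> inj1 X (TObj T A) (TObj T (zero_obj X))"

definition biprod_monad :: "('o, 'm, 'e) biprod_data_scheme \<Rightarrow> 'o \<Rightarrow> ('o, 'm) monad_data" where
  "biprod_monad X H = \<lparr>
     TObj = \<lambda>A. H \<oplus>\<^bsub>X\<^esub> A,
     TArr = \<lambda>f. biprod_map X (Id X H) f,
     mult = \<lambda>A. inj_n X [H, A] 1 \<cdot>\<^bsub>X\<^esub> proj_n X [H, H, A] 1
             \<^bold>+\<^bsub>X\<^esub> inj_n X [H, A] 1 \<cdot>\<^bsub>X\<^esub> proj_n X [H, H, A] 2
             \<^bold>+\<^bsub>X\<^esub> inj_n X [H, A] 2 \<cdot>\<^bsub>X\<^esub> proj_n X [H, H, A] 3,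
     unit = \<lambda>A. inj_n X [H, A] 2 \<rparr>"

end

theory Submission
  imports Defs
begin

text \<open>The maps into and out of a biproduct are determined by their components, and composition
  is bilinear for the induced addition. Componentwise, the fusion operator of \<open>H \<oplus> -\<close> is
  \<open>(x, a, y, b) \<mapsto> ((x, a), (x + y, b))\<close>, with inverse \<open>((x, a), (z, b)) \<mapsto> (x, a, z - x, b)\<close>;
  precomposing the inverse with the first injection yields \<open>(x, a) \<mapsto> (x, a, - x, 0)\<close>.\<close>

section \<open>Categories\<close>

text \<open>The axioms are restated with \<open>Arr\<close>, \<open>Dom\<close> and \<open>Cod\<close> in place of \<open>hom\<close>: the side conditions
  then have no extra variables, and the simplifier can discharge them.\<close>

context category
begin

lemma hom_iff: "f \<in> hom X A B \<longleftrightarrow> f \<in> Arr X \<and> Dom X f = A \<and> Cod X f = B"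
  by (auto simp: hom_def)

lemma Dom_Cod_Obj [simp]:
  assumes "f \<in> Arr X"
  shows "Dom X f \<in> Obj X" "Cod X f \<in> Obj X"
  using assms by (auto intro: Dom_Obj Cod_Obj)

lemma Id_simps [simp]:
  assumes "A \<in> Obj X"
  shows "Id X A \<in> Arr X" "Dom X (Id X A) = A" "Cod X (Id X A) = A"
  using Id_hom[OF assms] by (auto simp: hom_iff)

lemma Comp_simps [simp]:
  assumes "f \<in> Arr X" "g \<in> Arr X" "Dom X g = Cod X f"
  shows "g \<cdot> f \<in> Arr X" "Dom X (g \<cdot> f) = Dom X f" "Cod X (g \<cdot> f) = Cod X g"
  using Comp_hom[of f "Dom X f" "Cod X f" g "Cod X g"] assms by (auto simp: hom_iff)

lemma Comp_Id_left [simp]: "\<lbrakk>f \<in> Arr X; Cod X f = A\<rbrakk> \<Longrightarrow> Id X A \<cdot> f = f"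
  using Id_Comp[of f "Dom X f" A] by (auto simp: hom_iff)

lemma Comp_Id_right [simp]: "\<lbrakk>f \<in> Arr X; Dom X f = A\<rbrakk> \<Longrightarrow> f \<cdot> Id X A = f"
  using Comp_Id[of f A "Cod X f"] by (auto simp: hom_iff)

lemma Comp_assoc_Arr [simp]:
  "\<lbrakk>f \<in> Arr X; g \<in> Arr X; h \<in> Arr X; Dom X g = Cod X f; Dom X h = Cod X g\<rbrakk>
    \<Longrightarrow> (h \<cdot> g) \<cdot> f = h \<cdot> (g \<cdot> f)"
  using Comp_assoc[of f "Dom X f" "Cod X f" g "Cod X g" h "Cod X h"] by (auto simp: hom_iff)

text \<open>Inverses are unique: a second inverse \<open>k\<close> equals
  \<open>(g \<cdot> f) \<cdot> k = g \<cdot> (f \<cdot> k) = g\<close>. Exhibiting one inverse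
  therefore settles the definite description.\<close>

lemma inverse_of_eqI:
  assumes "inverse_arrows X f g"
  shows "inverse_of X f = g"
  unfolding inverse_of_def
proof (rule the_equality, fact assms)
  fix k assume k: "inverse_arrows X f k"
  have "(g \<cdot> f) \<cdot> k = g \<cdot> (f \<cdot> k)"
    by (rule Comp_assoc_Arr; use k assms in \<open>simp add: inverse_arrows_def hom_iff\<close>)
  then show "k = g"
    using k assms by (simp add: inverse_arrows_def hom_iff)
qed

end

section \<open>The additive structure of a category with finite biproducts\<close>

context finite_biproducts
begin

lemma zero_Obj' [simp]: "zero_obj X \<in> Obj X"
  by (rule zero_Obj)

lemma biprod_simps [simp]:
  assumes "A \<in> Obj X" "B \<in> Obj X"
  shows "A \<oplus> B \<in> Obj X"
    "inj1 X A B \<in> Arr X" "Dom X (inj1 X A B) = A" "Cod X (inj1 X A B) = A \<oplus> B"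
    "inj2 X A B \<in> Arr X" "Dom X (inj2 X A B) = B" "Cod X (inj2 X A B) = A \<oplus> B"
    "proj1 X A B \<in> Arr X" "Dom X (proj1 X A B) = A \<oplus> B" "Cod X (proj1 X A B) = A"
    "proj2 X A B \<in> Arr X" "Dom X (proj2 X A B) = A \<oplus> B" "Cod X (proj2 X A B) = B"
    "proj1 X A B \<cdot> inj1 X A B = Id X A" "proj2 X A B \<cdot> inj2 X A B = Id X B"
    "proj1 X A B \<cdot> inj2 X A B = zero_map X B A" "proj2 X A B \<cdot> inj1 X A B = zero_map X A B"
  using biprod_Obj inj1_hom inj2_hom proj1_hom proj2_hom
    proj1_inj1 proj2_inj2 proj1_inj2 proj2_inj1 assms
  by (auto simp: hom_iff)

text \<open>The uniqueness half of the universal property. With its dual it reduces equations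
  between maps to equations between components, which rewriting can decide.\<close>

lemma product_eqI:
  assumes "f \<in> hom X C (A \<oplus> B)" "g \<in> hom X C (A \<oplus> B)" "A \<in> Obj X" "B \<in> Obj X"
    and "proj1 X A B \<cdot> f = proj1 X A B \<cdot> g" "proj2 X A B \<cdot> f = proj2 X A B \<cdot> g"
  shows "f = g"
  using product[of A B "proj1 X A B \<cdot> g" C "proj2 X A B \<cdot> g"] assms by (auto simp: hom_iff)

lemma coproduct_eqI:
  assumes "f \<in> hom X (A \<oplus> B) C" "g \<in> hom X (A \<oplus> B) C" "A \<in> Obj X" "B \<in> Obj X"
    and "f \<cdot> inj1 X A B = g \<cdot> inj1 X A B" "f \<cdot> inj2 X A B = g \<cdot> inj2 X A B"
  shows "f = g"
  using coproduct[of A B "g \<cdot> inj1 X A B" C "g \<cdot> inj2 X A B"] assms by (auto simp: hom_iff)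

text \<open>Terminality and initiality make the two chosen factors in \<open>zero_map\<close>
  unique, so any factorization through the zero object may replace them.\<close>

lemma zero_map_factors:
  assumes "A \<in> Obj X" "B \<in> Obj X"
    and "t \<in> hom X A (zero_obj X)" "i \<in> hom X (zero_obj X) B"
  shows "zero_map X A B = i \<cdot> t"
  unfolding zero_map_def
  using the1_equality[OF zero_terminal[OF assms(1)] assms(3)]
    the1_equality[OF zero_initial[OF assms(2)] assms(4)] by simp

lemma zero_map_simps [simp]:
  assumes "A \<in> Obj X" "B \<in> Obj X"
  shows "zero_map X A B \<in> Arr X" "Dom X (zero_map X A B) = A" "Cod X (zero_map X A B) = B"
proof -
  obtain t i where "t \<in> hom X A (zero_obj X)" "i \<in> hom X (zero_obj X) B"
    using zero_terminal zero_initial assms by blast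
  then show "zero_map X A B \<in> Arr X" "Dom X (zero_map X A B) = A" "Cod X (zero_map X A B) = B"
    using zero_map_factors[OF assms, of t i] by (auto simp: hom_iff)
qed

lemma Comp_zero_map [simp]:
  assumes "f \<in> Arr X" "Dom X f = B" "A \<in> Obj X"
  shows "f \<cdot> zero_map X A B = zero_map X A (Cod X f)"
proof -
  have B: "B \<in> Obj X" using assms by auto
  obtain t i where ti: "t \<in> hom X A (zero_obj X)" "i \<in> hom X (zero_obj X) B"
    using zero_terminal zero_initial assms B by blast
  \<comment> \<open>Again a map out of the zero object, so it can serve as the second factor of the
    zero map into \<open>Cod X f\<close>.\<close>
  then have "f \<cdot> i \<in> hom X (zero_obj X) (Cod X f)"
    using assms by (simp add: hom_iff)
  then show ?thesis
    using zero_map_factors[of A B t i] zero_map_factors[of A "Cod X f" t "f \<cdot> i"] ti assms B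
    by (simp add: hom_iff)
qed

lemma zero_map_Comp [simp]:
  assumes "f \<in> Arr X" "Cod X f = A" "B \<in> Obj X"
  shows "zero_map X A B \<cdot> f = zero_map X (Dom X f) B"
proof -
  have A: "A \<in> Obj X" using assms by auto
  obtain t i where ti: "t \<in> hom X A (zero_obj X)" "i \<in> hom X (zero_obj X) B"
    using zero_terminal zero_initial assms A by blast
  then have "t \<cdot> f \<in> hom X (Dom X f) (zero_obj X)"
    using assms by (simp add: hom_iff)
  then show ?thesis
    using zero_map_factors[of A B t i] zero_map_factors[of "Dom X f" B "t \<cdot> f" i] ti assms A
    by (simp add: hom_iff)
qed

text \<open>Rewriting brackets composites to the right, so a projection meets an injection only
  inside a longer composite. The later rules ending in \<open>_Comp\<close> for pairings, copairings
  and \<open>biprod_map\<close> have the same purpose.\<close>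

lemma proj_inj_Comp [simp]:
  assumes "A \<in> Obj X" "B \<in> Obj X" "f \<in> Arr X"
  shows "Cod X f = A \<Longrightarrow> proj1 X A B \<cdot> (inj1 X A B \<cdot> f) = f"
    and "Cod X f = B \<Longrightarrow> proj2 X A B \<cdot> (inj2 X A B \<cdot> f) = f"
    and "Cod X f = B \<Longrightarrow> proj1 X A B \<cdot> (inj2 X A B \<cdot> f) = zero_map X (Dom X f) A"
    and "Cod X f = A \<Longrightarrow> proj2 X A B \<cdot> (inj1 X A B \<cdot> f) = zero_map X (Dom X f) B"
  using assms by (simp_all flip: Comp_assoc_Arr)

text \<open>The objects \<open>A\<close> and \<open>B\<close> are tied to the codomains by premises
  because goals usually contain these objects in simplified form, not literally as
  \<open>Cod X f\<close>.\<close>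

lemma pair_simps [simp]:
  assumes "f \<in> Arr X" "g \<in> Arr X" "Dom X g = Dom X f"
  shows "pair X f g \<in> Arr X" "Dom X (pair X f g) = Dom X f"
    "Cod X (pair X f g) = Cod X f \<oplus> Cod X g"
    and proj1_pair: "\<lbrakk>A = Cod X f; B = Cod X g\<rbrakk> \<Longrightarrow> proj1 X A B \<cdot> pair X f g = f"
    and proj2_pair: "\<lbrakk>A = Cod X f; B = Cod X g\<rbrakk> \<Longrightarrow> proj2 X A B \<cdot> pair X f g = g"
  using theI'[OF product[of "Cod X f" "Cod X g" f "Dom X f" g]] assms
  by (auto simp: pair_def hom_iff)

lemma copair_simps [simp]:
  assumes "f \<in> Arr X" "g \<in> Arr X" "Cod X g = Cod X f"
  shows "copair X f g \<in> Arr X" "Dom X (copair X f g) = Dom X f \<oplus> Dom X g"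
    "Cod X (copair X f g) = Cod X f"
    and copair_inj1: "\<lbrakk>A = Dom X f; B = Dom X g\<rbrakk> \<Longrightarrow> copair X f g \<cdot> inj1 X A B = f"
    and copair_inj2: "\<lbrakk>A = Dom X f; B = Dom X g\<rbrakk> \<Longrightarrow> copair X f g \<cdot> inj2 X A B = g"
  using theI'[OF coproduct[of "Dom X f" "Dom X g" f "Cod X f" g]] assms
  by (auto simp: copair_def hom_iff)

lemma proj_pair_Comp [simp]:
  assumes "f \<in> Arr X" "g \<in> Arr X" "Dom X g = Dom X f" "k \<in> Arr X" "Dom X f = Cod X k"
    and "A = Cod X f" "B = Cod X g"
  shows "proj1 X A B \<cdot> (pair X f g \<cdot> k) = f \<cdot> k" "proj2 X A B \<cdot> (pair X f g \<cdot> k) = g \<cdot> k"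
  using assms by (simp_all flip: Comp_assoc_Arr)

lemma copair_inj_Comp [simp]:
  assumes "f \<in> Arr X" "g \<in> Arr X" "Cod X g = Cod X f" "k \<in> Arr X"
    and "A = Dom X f" "B = Dom X g"
  shows "Cod X k = A \<Longrightarrow> copair X f g \<cdot> (inj1 X A B \<cdot> k) = f \<cdot> k"
    and "Cod X k = B \<Longrightarrow> copair X f g \<cdot> (inj2 X A B \<cdot> k) = g \<cdot> k"
  using assms by (simp_all flip: Comp_assoc_Arr)

lemma biprod_map_simps [simp]:
  assumes "f \<in> Arr X" "g \<in> Arr X"
  shows "biprod_map X f g \<in> Arr X" "Dom X (biprod_map X f g) = Dom X f \<oplus> Dom X g"
    "Cod X (biprod_map X f g) = Cod X f \<oplus> Cod X g"
  using assms by (simp_all add: biprod_map_def)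

lemma proj_biprod_map_Comp [simp]:
  assumes "f \<in> Arr X" "g \<in> Arr X" "A = Cod X f" "B = Cod X g"
    and "k \<in> Arr X" "Cod X k = Dom X f \<oplus> Dom X g"
  shows "proj1 X A B \<cdot> (biprod_map X f g \<cdot> k) = f \<cdot> (proj1 X (Dom X f) (Dom X g) \<cdot> k)"
    "proj2 X A B \<cdot> (biprod_map X f g \<cdot> k) = g \<cdot> (proj2 X (Dom X f) (Dom X g) \<cdot> k)"
  using assms by (simp_all add: biprod_map_def)

text \<open>\<open>biprod_map\<close> is defined through the product structure; comparing
  projections shows that it also acts summandwise on the coproduct structure, the mixed components
  being zero.\<close>

lemma biprod_map_inj [simp]:
  assumes "f \<in> Arr X" "g \<in> Arr X" "A = Dom X f" "B = Dom X g"
  shows "biprod_map X f g \<cdot> inj1 X A B = inj1 X (Cod X f) (Cod X g) \<cdot> f"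
    "biprod_map X f g \<cdot> inj2 X A B = inj2 X (Cod X f) (Cod X g) \<cdot> g"
  by (rule product_eqI[of _ _ "Cod X f" "Cod X g"]; use assms in \<open>simp add: hom_iff\<close>)+

lemma biprod_map_inj_Comp [simp]:
  assumes "f \<in> Arr X" "g \<in> Arr X" "A = Dom X f" "B = Dom X g" "k \<in> Arr X"
  shows "Cod X k = A \<Longrightarrow>
      biprod_map X f g \<cdot> (inj1 X A B \<cdot> k) = inj1 X (Cod X f) (Cod X g) \<cdot> (f \<cdot> k)"
    "Cod X k = B \<Longrightarrow>
      biprod_map X f g \<cdot> (inj2 X A B \<cdot> k) = inj2 X (Cod X f) (Cod X g) \<cdot> (g \<cdot> k)"
  using biprod_map_inj[OF assms(1-4)] assms by (simp_all flip: Comp_assoc_Arr)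

section \<open>The induced addition: bilinearity, zero, and the commutative monoid laws\<close>

lemma map_add_pair:
  assumes "f \<in> Arr X" "g \<in> Arr X" "Dom X g = Dom X f" "Cod X g = Cod X f"
  shows "f \<^bold>+ g = copair X (Id X (Cod X f)) (Id X (Cod X f)) \<cdot> pair X f g"
proof -
  have "biprod_map X f g \<cdot> pair X (Id X (Dom X f)) (Id X (Dom X f)) = pair X f g"
    by (rule product_eqI[of _ "Dom X f" "Cod X f" "Cod X g"]; use assms in \<open>simp add: hom_iff\<close>)
  then show ?thesis by (simp add: map_add_def)
qed

text \<open>Dual to the preceding form. Pairings absorb precomposition and copairings absorb
  postcomposition, so the two forms yield distributivity on the right and on the left
  respectively.\<close>

lemma map_add_copair:
  assumes "f \<in> Arr X" "g \<in> Arr X" "Dom X g = Dom X f" "Cod X g = Cod X f"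
  shows "f \<^bold>+ g = copair X f g \<cdot> pair X (Id X (Dom X f)) (Id X (Dom X f))"
proof -
  have "copair X (Id X (Cod X f)) (Id X (Cod X f)) \<cdot> biprod_map X f g = copair X f g"
    by (rule coproduct_eqI[of _ "Dom X f" "Dom X g" "Cod X f"];
        use assms in \<open>simp add: hom_iff\<close>)
  then show ?thesis using assms by (simp add: map_add_def flip: Comp_assoc_Arr)
qed

lemma map_add_simps [simp]:
  assumes "f \<in> Arr X" "g \<in> Arr X" "Dom X g = Dom X f" "Cod X g = Cod X f"
  shows "f \<^bold>+ g \<in> Arr X" "Dom X (f \<^bold>+ g) = Dom X f" "Cod X (f \<^bold>+ g) = Cod X f"
  using assms by (simp_all add: map_add_pair)

lemma map_add_Comp [simp]:
  assumes "f \<in> Arr X" "g \<in> Arr X" "Dom X g = Dom X f" "Cod X g = Cod X f"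
    and "k \<in> Arr X" "Dom X f = Cod X k"
  shows "(f \<^bold>+ g) \<cdot> k = f \<cdot> k \<^bold>+ g \<cdot> k"
proof -
  have "pair X f g \<cdot> k = pair X (f \<cdot> k) (g \<cdot> k)"
    by (rule product_eqI[of _ "Dom X k" "Cod X f" "Cod X g"]; use assms in \<open>simp add: hom_iff\<close>)
  then show ?thesis using assms by (simp add: map_add_pair)
qed

lemma Comp_map_add [simp]:
  assumes "f \<in> Arr X" "g \<in> Arr X" "Dom X g = Dom X f" "Cod X g = Cod X f"
    and "k \<in> Arr X" "Dom X k = Cod X f"
  shows "k \<cdot> (f \<^bold>+ g) = k \<cdot> f \<^bold>+ k \<cdot> g"
proof -
  have "k \<cdot> copair X f g = copair X (k \<cdot> f) (k \<cdot> g)"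
    by (rule coproduct_eqI[of _ "Dom X f" "Dom X g" "Cod X k"]; use assms in \<open>simp add: hom_iff\<close>)
  then show ?thesis using assms by (simp add: map_add_copair flip: Comp_assoc_Arr)
qed

lemma map_add_zero_right [simp]:
  assumes "f \<in> Arr X" "Dom X f = A" "Cod X f = B"
  shows "f \<^bold>+ zero_map X A B = f"
proof -
  have AB: "A \<in> Obj X" "B \<in> Obj X" using assms by auto
  \<comment> \<open>The codiagonal cancels the injection, leaving \<open>f\<close>.\<close>
  have "pair X f (zero_map X A B) = inj1 X B B \<cdot> f"
    by (rule product_eqI[of _ A B B]; use assms AB in \<open>simp add: hom_iff\<close>)
  then show ?thesis using assms AB by (simp add: map_add_pair)
qed

lemma map_add_zero_left [simp]:
  assumes "f \<in> Arr X" "Dom X f = A" "Cod X f = B"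
  shows "zero_map X A B \<^bold>+ f = f"
proof -
  have AB: "A \<in> Obj X" "B \<in> Obj X" using assms by auto
  have "pair X (zero_map X A B) f = inj2 X B B \<cdot> f"
    by (rule product_eqI[of _ A B B]; use assms AB in \<open>simp add: hom_iff\<close>)
  then show ?thesis using assms AB by (simp add: map_add_pair)
qed

text \<open>Associativity and commutativity both follow from this by the Eckmann--Hilton argument.\<close>

lemma map_add_interchange:
  assumes "a \<in> hom X A B" "b \<in> hom X A B" "c \<in> hom X A B" "d \<in> hom X A B"
  shows "(a \<^bold>+ b) \<^bold>+ (c \<^bold>+ d) = (a \<^bold>+ c) \<^bold>+ (b \<^bold>+ d)"
proof -
  have "B \<in> Obj X" using assms by (auto simp: hom_iff)
  moreover have "pair X a b \<^bold>+ pair X c d = pair X (a \<^bold>+ c) (b \<^bold>+ d)"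
    by (rule product_eqI[of _ A B B]; use assms calculation in \<open>simp add: hom_iff\<close>)
  \<comment> \<open>Sums of pairings are componentwise, and the codiagonal distributes over sums
    while adding up the components of a pairing.\<close>
  then have "copair X (Id X B) (Id X B) \<cdot> (pair X a b \<^bold>+ pair X c d)
      = copair X (Id X B) (Id X B) \<cdot> pair X (a \<^bold>+ c) (b \<^bold>+ d)" by simp
  ultimately show ?thesis
    using assms map_add_pair[of a b] map_add_pair[of c d] map_add_pair[of "a \<^bold>+ c" "b \<^bold>+ d"]
    by (simp add: hom_iff)
qed

lemma map_add_assoc:
  assumes "f \<in> Arr X" "g \<in> Arr X" "h \<in> Arr X" "Dom X g = Dom X f" "Cod X g = Cod X f"
    "Dom X h = Dom X f" "Cod X h = Cod X f"
  shows "(f \<^bold>+ g) \<^bold>+ h = f \<^bold>+ (g \<^bold>+ h)"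
  \<comment> \<open>The instance \<open>(f + g) + (0 + h) = (f + 0) + (g + h)\<close>.\<close>
  using map_add_interchange[of f "Dom X f" "Cod X f" g "zero_map X (Dom X f) (Cod X f)" h] assms
  by (simp add: hom_iff)

lemma map_add_commute:
  assumes "f \<in> Arr X" "g \<in> Arr X" "Dom X g = Dom X f" "Cod X g = Cod X f"
  shows "f \<^bold>+ g = g \<^bold>+ f"
  \<comment> \<open>The instance \<open>(0 + f) + (g + 0) = (0 + g) + (f + 0)\<close>.\<close>
  using map_add_interchange[of "zero_map X (Dom X f) (Cod X f)" "Dom X f" "Cod X f" f g
      "zero_map X (Dom X f) (Cod X f)"] assms
  by (simp add: hom_iff)

section \<open>The monad \<open>H \<oplus> -\<close>\<close>

lemma biprod_monad_simps [simp]: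
  "TObj (biprod_monad X H) A = H \<oplus> A"
  "TArr (biprod_monad X H) f = biprod_map X (Id X H) f"
  "\<lbrakk>H \<in> Obj X; A \<in> Obj X\<rbrakk> \<Longrightarrow> unit (biprod_monad X H) A = inj2 X H A"
  by (simp_all add: biprod_monad_def)

text \<open>On elements both sides are \<open>(x, y, a) \<mapsto> (x + y, a)\<close>. The copairing
  form contains no sums, so later equations can be evaluated on injections directly.\<close>

lemma mult_biprod_monad:
  assumes "H \<in> Obj X" "A \<in> Obj X"
  shows "mult (biprod_monad X H) A = copair X (inj1 X H A) (Id X (H \<oplus> A))"
proof (rule coproduct_eqI[of _ H "H \<oplus> A" "H \<oplus> A"])
  show "mult (biprod_monad X H) A \<cdot> inj2 X H (H \<oplus> A) =
      copair X (inj1 X H A) (Id X (H \<oplus> A)) \<cdot> inj2 X H (H \<oplus> A)"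
    by (rule coproduct_eqI[of _ H A "H \<oplus> A"];
        use assms in \<open>simp add: hom_iff biprod_monad_def\<close>)
qed (use assms in \<open>simp_all add: hom_iff biprod_monad_def\<close>)

lemma monad_biprod_monad:
  assumes H: "H \<in> Obj X"
  shows "monad X (biprod_monad X H)"
proof unfold_locales
  let ?T = "biprod_monad X H"
  fix A B C f g
  show "A \<in> Obj X \<Longrightarrow> TObj ?T A \<in> Obj X"
    using H by simp
  show "f \<in> hom X A B \<Longrightarrow> TArr ?T f \<in> hom X (TObj ?T A) (TObj ?T B)"
    using H by (simp add: hom_iff)
  show "A \<in> Obj X \<Longrightarrow> mult ?T A \<in> hom X (TObj ?T (TObj ?T A)) (TObj ?T A)"
    using H by (simp add: hom_iff mult_biprod_monad)
  show "A \<in> Obj X \<Longrightarrow> unit ?T A \<in> hom X A (TObj ?T A)"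
    using H by (simp add: hom_iff)
  show "TArr ?T (Id X A) = Id X (TObj ?T A)" if "A \<in> Obj X"
    by (rule coproduct_eqI[of _ H A "H \<oplus> A"]; use that H in \<open>simp add: hom_iff\<close>)
  show "TArr ?T (g \<cdot> f) = TArr ?T g \<cdot> TArr ?T f" if "f \<in> hom X A B" "g \<in> hom X B C"
    by (rule coproduct_eqI[of _ H A "H \<oplus> C"]; use that H in \<open>auto simp: hom_iff\<close>)
  show "mult ?T B \<cdot> TArr ?T (TArr ?T f) = TArr ?T f \<cdot> mult ?T A" if "f \<in> hom X A B"
    by (rule coproduct_eqI[of _ H "H \<oplus> A" "H \<oplus> B"];
        use that H in \<open>auto simp: hom_iff mult_biprod_monad\<close>)
  show "unit ?T B \<cdot> f = TArr ?T f \<cdot> unit ?T A" if "f \<in> hom X A B"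
    using that H by (auto simp: hom_iff)
  \<comment> \<open>A single split suffices: on the second summand both sides restrict to
    \<open>mult ?T A\<close>, on the first to \<open>inj1 X H A\<close>.\<close>
  show "mult ?T A \<cdot> TArr ?T (mult ?T A) = mult ?T A \<cdot> mult ?T (TObj ?T A)" if "A \<in> Obj X"
    by (rule coproduct_eqI[of _ H "H \<oplus> (H \<oplus> A)" "H \<oplus> A"];
        use that H in \<open>simp add: hom_iff mult_biprod_monad\<close>)
  show "mult ?T A \<cdot> unit ?T (TObj ?T A) = Id X (TObj ?T A)" if "A \<in> Obj X"
    using that H by (simp add: mult_biprod_monad)
  show "mult ?T A \<cdot> TArr ?T (unit ?T A) = Id X (TObj ?T A)" if "A \<in> Obj X"
    by (rule coproduct_eqI[of _ H A "H \<oplus> A"];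
        use that H in \<open>simp add: hom_iff mult_biprod_monad\<close>)
qed

section \<open>The fusion operator and its inverse\<close>

lemma fusion_biprod_monad:
  assumes "H \<in> Obj X" "A \<in> Obj X" "B \<in> Obj X"
  shows "fusion X (biprod_monad X H) A B =
    copair X
      (inj1 X (H \<oplus> A) (H \<oplus> B) \<cdot> inj1 X H A \<^bold>+ inj2 X (H \<oplus> A) (H \<oplus> B) \<cdot> inj1 X H B)
      (copair X (inj1 X (H \<oplus> A) (H \<oplus> B) \<cdot> inj2 X H A) (inj2 X (H \<oplus> A) (H \<oplus> B)))"
    (is "?h = ?k")
proof (rule coproduct_eqI[of _ H "A \<oplus> (H \<oplus> B)" "(H \<oplus> A) \<oplus> (H \<oplus> B)"])
  \<comment> \<open>Only the leading \<open>H\<close> is sent to a sum, since it survives in both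
    terms of the fusion operator; \<open>A\<close> and \<open>H \<oplus> B\<close> each reach just
    one side.\<close>
  show "?h \<cdot> inj2 X H (A \<oplus> (H \<oplus> B)) = ?k \<cdot> inj2 X H (A \<oplus> (H \<oplus> B))"
    by (rule coproduct_eqI[of _ A "H \<oplus> B" "(H \<oplus> A) \<oplus> (H \<oplus> B)"];
        use assms in \<open>simp add: hom_iff fusion_def mult_biprod_monad\<close>)
qed (use assms in \<open>simp_all add: hom_iff fusion_def mult_biprod_monad\<close>)

text \<open>\<open>TArr T\<close> is the identity on \<open>H\<close>, so on each summand both
  composites apply \<open>f\<close>, \<open>g\<close> or an identity and then inject in the same
  way.\<close>

lemma fusion_biprod_monad_natural:
  assumes "H \<in> Obj X" "f \<in> hom X A A'" "g \<in> hom X B B'"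
  defines "T \<equiv> biprod_monad X H"
  shows "fusion X T A' B' \<cdot> TArr T (biprod_map X f (TArr T g))
    = biprod_map X (TArr T f) (TArr T g) \<cdot> fusion X T A B" (is "?h = ?k")
proof (rule coproduct_eqI[of _ H "A \<oplus> (H \<oplus> B)" "(H \<oplus> A') \<oplus> (H \<oplus> B')"])
  have obj: "A \<in> Obj X" "A' \<in> Obj X" "B \<in> Obj X" "B' \<in> Obj X"
    using assms by (auto simp: hom_iff)
  note defs = hom_iff fusion_biprod_monad T_def
  show "?h \<cdot> inj2 X H (A \<oplus> (H \<oplus> B)) = ?k \<cdot> inj2 X H (A \<oplus> (H \<oplus> B))"
    by (rule coproduct_eqI[of _ A "H \<oplus> B" "(H \<oplus> A') \<oplus> (H \<oplus> B')"];
        use assms(1-3) obj in \<open>simp add: defs\<close>)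
  show "?h \<in> hom X (H \<oplus> (A \<oplus> (H \<oplus> B))) ((H \<oplus> A') \<oplus> (H \<oplus> B'))"
    "?k \<in> hom X (H \<oplus> (A \<oplus> (H \<oplus> B))) ((H \<oplus> A') \<oplus> (H \<oplus> B'))"
    "H \<in> Obj X" "A \<oplus> (H \<oplus> B) \<in> Obj X"
    "?h \<cdot> inj1 X H (A \<oplus> (H \<oplus> B)) = ?k \<cdot> inj1 X H (A \<oplus> (H \<oplus> B))"
    using assms(1-3) obj by (simp_all add: defs)
qed

text \<open>Distributivity gives
  \<open>f + f \<cdot> neg = f \<cdot> (1 + neg) = f \<cdot> 0 = 0\<close>. The reverse order, not
  part of \<open>additive_inverse\<close>, comes from commutativity.\<close>

lemma map_add_Comp_additive_inverse:
  assumes "additive_inverse X (Id X H) neg" "H \<in> Obj X" "f \<in> Arr X" "Dom X f = H"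
  shows "f \<^bold>+ f \<cdot> neg = zero_map X H (Cod X f)" "f \<cdot> neg \<^bold>+ f = zero_map X H (Cod X f)"
proof -
  have neg: "neg \<in> Arr X" "Dom X neg = H" "Cod X neg = H" "Id X H \<^bold>+ neg = zero_map X H H"
    using assms by (auto simp: additive_inverse_def hom_iff)
  \<comment> \<open>The sum is replaced by zero before simplification can distribute
    \<open>f\<close> over it; the next step then distributes.\<close>
  have "f \<cdot> (Id X H \<^bold>+ neg) = zero_map X H (Cod X f)"
    unfolding neg(4) using assms by simp
  then show *: "f \<^bold>+ f \<cdot> neg = zero_map X H (Cod X f)"
    using assms neg(1-3) by simp
  show "f \<cdot> neg \<^bold>+ f = zero_map X H (Cod X f)"
    unfolding *[symmetric] by (rule map_add_commute) (use assms neg(1-3) in simp_all)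
qed

text \<open>The map \<open>((x, a), (z, b)) \<mapsto> (x, a, z - x, b)\<close>, given by its values
  on \<open>H\<close>, \<open>A\<close> and \<open>H \<oplus> B\<close>. The \<open>neg\<close> term
  carries \<open>- x\<close> to the second copy of \<open>H\<close>.\<close>

definition fusion_inverse :: "'o \<Rightarrow> 'm \<Rightarrow> 'o \<Rightarrow> 'o \<Rightarrow> 'm" where
  "fusion_inverse H neg A B = copair X
     (copair X
       (inj1 X H (A \<oplus> (H \<oplus> B))
         \<^bold>+ inj2 X H (A \<oplus> (H \<oplus> B)) \<cdot> inj2 X A (H \<oplus> B) \<cdot> inj1 X H B \<cdot> neg)
       (inj2 X H (A \<oplus> (H \<oplus> B)) \<cdot> inj1 X A (H \<oplus> B)))
     (inj2 X H (A \<oplus> (H \<oplus> B)) \<cdot> inj2 X A (H \<oplus> B))"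

lemma inverse_arrows_fusion:
  assumes "H \<in> Obj X" "A \<in> Obj X" "B \<in> Obj X" "additive_inverse X (Id X H) neg"
  shows "inverse_arrows X (fusion X (biprod_monad X H) A B) (fusion_inverse H neg A B)"
    (is "inverse_arrows X ?h ?k")
proof -
  let ?S = "H \<oplus> (A \<oplus> (H \<oplus> B))" and ?R = "(H \<oplus> A) \<oplus> (H \<oplus> B)"
  have neg: "neg \<in> Arr X" "Dom X neg = H" "Cod X neg = H"
    using assms by (auto simp: additive_inverse_def hom_iff)
  note cancel = map_add_Comp_additive_inverse[OF assms(4,1)]
  \<comment> \<open>On the leading \<open>H\<close>, \<open>?h \<cdot> ?k\<close> produces
    \<open>x + (- x)\<close> and \<open>?k \<cdot> ?h\<close> produces \<open>- x + x\<close>, each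
    after one further term. Reassociation exposes these pairs, so both orders of cancellation
    occur.\<close>
  have cancel_R: "inj2 X (H \<oplus> A) (H \<oplus> B) \<cdot> inj1 X H B
      \<^bold>+ inj2 X (H \<oplus> A) (H \<oplus> B) \<cdot> inj1 X H B \<cdot> neg = zero_map X H ?R"
    using cancel(1)[of "inj2 X (H \<oplus> A) (H \<oplus> B) \<cdot> inj1 X H B"] assms neg by simp
  have cancel_S: "inj2 X H (A \<oplus> (H \<oplus> B)) \<cdot> inj2 X A (H \<oplus> B) \<cdot> inj1 X H B \<cdot> neg
      \<^bold>+ inj2 X H (A \<oplus> (H \<oplus> B)) \<cdot> inj2 X A (H \<oplus> B) \<cdot> inj1 X H B = zero_map X H ?S"
    using cancel(2)[of "inj2 X H (A \<oplus> (H \<oplus> B)) \<cdot> inj2 X A (H \<oplus> B) \<cdot> inj1 X H B"] assms neg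
    by simp
  note defs = hom_iff fusion_biprod_monad fusion_inverse_def map_add_assoc cancel_R cancel_S
  have h: "?h \<in> hom X ?S ?R" and k: "?k \<in> hom X ?R ?S"
    using assms neg by (simp_all add: defs)
  have "?k \<cdot> ?h = Id X ?S"
  proof (rule coproduct_eqI[of _ H "A \<oplus> (H \<oplus> B)" ?S])
    show "(?k \<cdot> ?h) \<cdot> inj2 X H (A \<oplus> (H \<oplus> B)) = Id X ?S \<cdot> inj2 X H (A \<oplus> (H \<oplus> B))"
      by (rule coproduct_eqI[of _ A "H \<oplus> B" ?S]; use assms neg in \<open>simp add: defs\<close>)
  qed (use assms neg in \<open>simp_all add: defs\<close>)
  moreover have "?h \<cdot> ?k = Id X ?R"
  proof (rule coproduct_eqI[of _ "H \<oplus> A" "H \<oplus> B" ?R])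
    show "(?h \<cdot> ?k) \<cdot> inj1 X (H \<oplus> A) (H \<oplus> B) = Id X ?R \<cdot> inj1 X (H \<oplus> A) (H \<oplus> B)"
      by (rule coproduct_eqI[of _ H A ?R]; use assms neg in \<open>simp add: defs\<close>)
    show "(?h \<cdot> ?k) \<cdot> inj2 X (H \<oplus> A) (H \<oplus> B) = Id X ?R \<cdot> inj2 X (H \<oplus> A) (H \<oplus> B)"
      by (rule coproduct_eqI[of _ H B ?R]; use assms neg in \<open>simp add: defs\<close>)
  qed (use assms neg in \<open>simp_all add: defs\<close>)
  ultimately show ?thesis
    using h k by (auto simp: inverse_arrows_def hom_iff)
qed

lemma hopf_monad_biprod_monad:
  assumes "H \<in> Obj X" "additive_inverse X (Id X H) neg"
  shows "hopf_monad X (biprod_monad X H)"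
proof -
  interpret monad X "biprod_monad X H"
    using assms(1) by (rule monad_biprod_monad)
  show ?thesis
  proof unfold_locales
    fix A B assume "A \<in> Obj X" "B \<in> Obj X"
    then show "fusion X (biprod_monad X H) A B \<in> hom X
        (TObj (biprod_monad X H) (A \<oplus> TObj (biprod_monad X H) B))
        (TObj (biprod_monad X H) A \<oplus> TObj (biprod_monad X H) B)"
      using assms(1) by (simp add: hom_iff fusion_biprod_monad)
    show "iso X (fusion X (biprod_monad X H) A B)"
      unfolding iso_def using inverse_arrows_fusion assms \<open>A \<in> Obj X\<close> \<open>B \<in> Obj X\<close> by blast
  qed (rule fusion_biprod_monad_natural[OF assms(1)])
qed

section \<open>The fusion invertor\<close>

lemma fusion_invertor_biprod_monad:
  assumes "H \<in> Obj X" "A \<in> Obj X" "additive_inverse X (Id X H) neg"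
  shows "fusion_invertor X (biprod_monad X H) A =
       inj_n X [H, A, H, zero_obj X] 1 \<cdot> proj_n X [H, A] 1
       \<^bold>+ inj_n X [H, A, H, zero_obj X] 2 \<cdot> proj_n X [H, A] 2
       \<^bold>+ inj_n X [H, A, H, zero_obj X] 3 \<cdot> neg \<cdot> proj_n X [H, A] 1"
proof -
  have neg: "neg \<in> Arr X" "Dom X neg = H" "Cod X neg = H"
    using assms by (auto simp: additive_inverse_def hom_iff)
  have "fusion_invertor X (biprod_monad X H) A =
      fusion_inverse H neg A (zero_obj X) \<cdot> inj1 X (H \<oplus> A) (H \<oplus> zero_obj X)"
    using inverse_of_eqI[OF inverse_arrows_fusion] assms by (simp add: fusion_invertor_def)
  also have "\<dots> = inj_n X [H, A, H, zero_obj X] 1 \<cdot> proj_n X [H, A] 1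
       \<^bold>+ inj_n X [H, A, H, zero_obj X] 2 \<cdot> proj_n X [H, A] 2
       \<^bold>+ inj_n X [H, A, H, zero_obj X] 3 \<cdot> neg \<cdot> proj_n X [H, A] 1"
    \<comment> \<open>The first injection selects the inner copairing of
      \<open>fusion_inverse\<close>. On \<open>H\<close> the middle term of the sum vanishes; on
      \<open>A\<close> the two terms through \<open>proj_n X [H, A] 1\<close> vanish. Nothing
      reaches the fourth summand.\<close>
    by (rule coproduct_eqI[of _ H A "H \<oplus> (A \<oplus> (H \<oplus> zero_obj X))"];
        use assms neg in \<open>simp add: hom_iff fusion_inverse_def\<close>)
  finally show ?thesis .
qed

end

theorem lemma4p1:
  fixes X :: "('o, 'm) biprod_data" (structure)
    and H :: 'o and neg :: 'm
  assumes "finite_biproducts X"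
    and "H \<in> Obj X"
    and "additive_inverse X (Id X H) neg"
  shows "hopf_monad X (biprod_monad X H) \<and>
    (\<forall>A\<in>Obj X. fusion_invertor X (biprod_monad X H) A =
       inj_n X [H, A, H, zero_obj X] 1 \<cdot> proj_n X [H, A] 1
       \<^bold>+ inj_n X [H, A, H, zero_obj X] 2 \<cdot> proj_n X [H, A] 2
       \<^bold>+ inj_n X [H, A, H, zero_obj X] 3 \<cdot> neg \<cdot> proj_n X [H, A] 1)"
proof -
  interpret finite_biproducts X by fact
  show ?thesis
    using hopf_monad_biprod_monad fusion_invertor_biprod_monad assms(2,3) by blast
qed

end
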